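(* Let $a$ be a primitive element of $\mathbb{F}_{2^6}$, identify $\mathbb{F}_2^6$ with $\mathbb{F}_{2^6}$, and let $\Gamma_{21}$ be the group generated by the $\mathbb{F}_2$-linear map $x\mapsto a^{21}x$, acting on the $3$-dimensional subspaces of $\mathbb{F}_2^6$. For every $\gamma_1\in\{12,15,18,24,27,30\}$ there exists a completely regular code $C$ in the Grassmann graph $J_2(6,3)$ with covering radius $1$ and intersection array $\{93-\gamma_1;\gamma_1\}$ that is invariant under $\Gamma_{21}$.
   Context: The Grassmann graph $J_2(6,3)$ has as vertices the $3$-dimensional subspaces of $\mathbb{F}_2^6$, adjacent iff they meet in a $2$-dimensional subspace; it is $98$-regular. A vertex set $C$ is a completely regular code with covering radius $1$ and intersection array $\{\beta_0;\gamma_1\}$ if $C$ and its complement are nonempty, every vertex of $C$ has exactly $\beta_0$ neighbours outside $C$, and every vertex outside $C$ has exactly $\gamma_1$ neighbours in $C$. $C$ is invariant under $\Gamma_{21}$ if the image of every element of $C$ under every element of $\Gamma_{21}$ lies in $C$. *)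

theory Defs
  imports Main
begin

text \<open>Concrete model of the field with 64 elements: F_2[x]/(x^6+x+1).
  An element is a natural number below 64 whose binary digits are the
  coefficients of a polynomial of degree < 6 over F_2. Addition is bitwise
  xor; this identifies F_2^6 (as an F_2-vector space) with the field.\<close>

definition F64 :: "nat set" where
  "F64 = {0..<64}"

definition gf_add :: "nat \<Rightarrow> nat \<Rightarrow> nat" where
  "gf_add x y = xor x y"

definition clmul :: "nat \<Rightarrow> nat \<Rightarrow> nat" where
  "clmul x y = fold (\<lambda>i acc. if bit y i then xor acc (x * 2 ^ i) else acc) [0..<6] 0"

text \<open>Reduction modulo x^6 + x + 1 (binary 1000011 = 67) of a polynomial of degree < 11.\<close>
definition gf_reduce :: "nat \<Rightarrow> nat" where
  "gf_reduce p = fold (\<lambda>i acc. if bit acc i then xor acc (67 * 2 ^ (i - 6)) else acc)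
                      (rev [6..<11]) p"

definition gf_mul :: "nat \<Rightarrow> nat \<Rightarrow> nat" where
  "gf_mul x y = gf_reduce (clmul x y)"

definition gf_pow :: "nat \<Rightarrow> nat \<Rightarrow> nat" where
  "gf_pow x k = ((\<lambda>z. gf_mul x z) ^^ k) 1"

definition primitive_elem :: "nat \<Rightarrow> bool" where
  "primitive_elem a \<longleftrightarrow> a \<in> F64 \<and> a \<noteq> 0 \<and> gf_pow a 63 = 1 \<and>
     (\<forall>k. 0 < k \<and> k < 63 \<longrightarrow> gf_pow a k \<noteq> 1)"

definition subspace2 :: "nat set \<Rightarrow> bool" where
  "subspace2 V \<longleftrightarrow> V \<subseteq> F64 \<and> 0 \<in> V \<and> (\<forall>x\<in>V. \<forall>y\<in>V. gf_add x y \<in> V)"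

definition has_dim :: "nat set \<Rightarrow> nat \<Rightarrow> bool" where
  "has_dim V k \<longleftrightarrow> subspace2 V \<and> card V = 2 ^ k"

definition J263_vertices :: "nat set set" where
  "J263_vertices = {V. has_dim V 3}"

definition J263_adj :: "nat set \<Rightarrow> nat set \<Rightarrow> bool" where
  "J263_adj V W \<longleftrightarrow> V \<in> J263_vertices \<and> W \<in> J263_vertices \<and> has_dim (V \<inter> W) 2"

definition CR1_code :: "nat set set \<Rightarrow> nat \<Rightarrow> nat \<Rightarrow> bool" where
  "CR1_code C b0 g1 \<longleftrightarrow>
     C \<subseteq> J263_vertices \<and> C \<noteq> {} \<and> J263_vertices - C \<noteq> {} \<and>
     (\<forall>v\<in>C. card {w \<in> J263_vertices - C. J263_adj v w} = b0) \<and>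
     (\<forall>v\<in>J263_vertices - C. card {w \<in> C. J263_adj v w} = g1)"

text \<open>Gamma_21: the group generated by x \<mapsto> a^21 x (cyclic, finite, so it consists of the powers).\<close>
definition Gamma21 :: "nat \<Rightarrow> (nat \<Rightarrow> nat) set" where
  "Gamma21 a = {(\<lambda>x. gf_mul (gf_pow a 21) x) ^^ k | k. True}"

definition invariant_under :: "nat set set \<Rightarrow> (nat \<Rightarrow> nat) set \<Rightarrow> bool" where
  "invariant_under C G \<longleftrightarrow> (\<forall>g\<in>G. \<forall>V\<in>C. g ` V \<in> C)"

end

(* Each plane V contains 7 lines, each line lies in 15 planes, and a plane W \<noteq> V is adjacent to V
   iff it shares a line with V, which is then unique.  So C has intersection array {93-g; g} as soon
   as the sum over the lines U of V of the number of members of C through U is g + 12 [V \<in> C]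
   (the 12 = 5 + 7 being the eigenvalue 5 of J_2(6,3) shifted by the 7 times V itself is counted).
   The left side is additive in C, so disjoint codes with parameters g and h unite to one with
   parameter g + h.  Hence four codes suffice: those for 12, 15, 18, 24, where the first is disjoint
   from the second and the third; 27 = 12 + 15 and 30 = 12 + 18.  They were found by a computer
   search over unions of orbits of subgroups of \<Gamma>L(3,4) containing the scalars, and they are given
   by a table indexed by reduced echelon bases.  The identity is checked for all 1395 planes and
   all four codes at once, with the four counts packed into one number in base 1000. *)
theory Submission
  imports Defs
begin

section \<open>Addition and leading bits\<close>

notation gf_add (infixl "\<oplus>" 65)

lemma gf_add_assoc: "(x \<oplus> y) \<oplus> z = x \<oplus> (y \<oplus> z)"
  and gf_add_commute: "x \<oplus> y = y \<oplus> x"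
  and gf_add_left_commute: "x \<oplus> (y \<oplus> z) = y \<oplus> (x \<oplus> z)"
  by (simp_all add: gf_add_def ac_simps)

lemmas gf_add_ac = gf_add_assoc gf_add_commute gf_add_left_commute

lemma gf_add_self [simp]: "x \<oplus> x = 0"
  and gf_add_0_left [simp]: "0 \<oplus> x = x"
  and gf_add_0_right [simp]: "x \<oplus> 0 = x"
  and gf_add_cancel [simp]: "x \<oplus> (x \<oplus> y) = y"
  by (simp_all add: gf_add_def flip: xor.assoc)

lemma gf_add_eq_0_iff [simp]: "x \<oplus> y = 0 \<longleftrightarrow> x = y"
  by (metis gf_add_cancel gf_add_0_right gf_add_self)

lemma gf_add_left_cancel [simp]: "x \<oplus> y = x \<oplus> z \<longleftrightarrow> y = z"
  by (metis gf_add_cancel)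

lemma gf_add_right_cancel [simp]: "y \<oplus> x = z \<oplus> x \<longleftrightarrow> y = z"
  by (metis gf_add_left_cancel gf_add_commute)

lemma gf_add_eq_left_iff [simp]: "x \<oplus> y = x \<longleftrightarrow> y = 0" "x \<oplus> y = y \<longleftrightarrow> x = 0"
  "x = x \<oplus> y \<longleftrightarrow> y = 0" "y = x \<oplus> y \<longleftrightarrow> x = 0"
  by (metis gf_add_cancel gf_add_0_right gf_add_self gf_add_commute)+

lemma gf_add_less_power: "x \<oplus> y < 2 ^ n" if "x < 2 ^ n" "y < 2 ^ n"
  using that unfolding gf_add_def
  by (metis take_bit_nat_eq_self take_bit_nat_less_exp take_bit_xor)

lemma gf_add_less_64: "x \<oplus> y < 64" if "x < 64" "y < 64"
  using gf_add_less_power[of x 6 y] that by simp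

lemma bit_gf_add: "bit (x \<oplus> y) n \<longleftrightarrow> bit x n \<noteq> bit y n"
  by (simp add: gf_add_def bit_xor_iff)

text \<open>Equivalently: \<open>y\<close> has digit 0 at the leading bit of \<open>x\<close>, see \<open>reduced_iff\<close>. Stated through the
  order, so that reduced echelon bases become greedily minimal ones.\<close>

definition reduced :: "nat \<Rightarrow> nat \<Rightarrow> bool" where
  "reduced x y \<longleftrightarrow> y < x \<oplus> y"

lemma top_bit:
  assumes "0 < (x :: nat)"
  obtains n where "bit x n" "2 ^ n \<le> x" "x < 2 ^ Suc n"
proof -
  obtain n where n: "2 ^ n \<le> x" "x < 2 ^ Suc n"
    using ex_power_ivl1[of 2 x] assms by auto
  then have "x div 2 ^ n = 1" by (intro div_nat_eqI) auto
  then have "bit x n" by (simp add: bit_iff_odd)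
  with n show thesis by (rule that[rotated])
qed

text \<open>Digit \<open>n\<close> is the leading one of \<open>x\<close>, so adding
  \<open>x\<close> keeps the digits of \<open>y\<close> above \<open>n\<close> and flips digit
  \<open>n\<close>, which therefore decides the comparison. The converse is the same inequality at
  \<open>x \<oplus> y\<close>.\<close>

lemma reduced_iff:
  assumes "bit x n" "x < 2 ^ Suc n"
  shows "reduced x y \<longleftrightarrow> \<not> bit y n"
proof -
  have less: "y < x \<oplus> y" if "\<not> bit y n" for y
  proof -
    have high: "drop_bit (Suc n) (x \<oplus> y) = drop_bit (Suc n) y"
    proof -
      have "drop_bit (Suc n) x = 0" using assms(2) by (simp add: drop_bit_eq_div)
      then show ?thesis by (simp add: gf_add_def drop_bit_xor del: drop_bit_Suc)
    qed
    have "take_bit (Suc n) y = take_bit n y"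
      using that by (simp add: take_bit_Suc_from_most)
    then have "take_bit (Suc n) y < 2 ^ n" by simp
    moreover have "take_bit (Suc n) (x \<oplus> y) = 2 ^ n + take_bit n (x \<oplus> y)"
      using that assms(1) by (simp add: take_bit_Suc_from_most bit_gf_add)
    ultimately have "take_bit (Suc n) y < take_bit (Suc n) (x \<oplus> y)" by simp
    moreover have "v = 2 ^ Suc n * drop_bit (Suc n) v + take_bit (Suc n) v" for v :: nat
      by (metis bits_ident push_bit_eq_mult mult.commute)
    ultimately show ?thesis using high by (metis add_less_cancel_left)
  qed
  show ?thesis
  proof
    assume r: "reduced x y"
    show "\<not> bit y n"
    proof
      assume "bit y n"
      then have "\<not> bit (x \<oplus> y) n" using assms(1) by (simp add: bit_gf_add)
      then have "x \<oplus> y < x \<oplus> (x \<oplus> y)" by (rule less)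
      then show False using r by (simp add: reduced_def)
    qed
  qed (simp add: less reduced_def)
qed

lemma reduced_nonzero: "reduced x y \<Longrightarrow> 0 < x"
  by (auto simp: reduced_def intro: gr0I)

lemma reduced_add: "reduced x y \<Longrightarrow> reduced x z \<Longrightarrow> reduced x (y \<oplus> z)"
  by (rule top_bit[OF reduced_nonzero, of x y]) (auto simp: reduced_iff bit_gf_add)

lemma not_reduced: "0 < x \<Longrightarrow> \<not> reduced x y \<Longrightarrow> x \<oplus> y < y"
  by (metis gf_add_eq_left_iff(2) linorder_neqE_nat reduced_def neq0_conv)

lemma reduced_min: "0 < x \<Longrightarrow> reduced x (min y (x \<oplus> y))"
  using not_reduced[of x y] by (cases "reduced x y") (simp_all add: reduced_def min_def)

lemma reduced_swap: "x < y \<Longrightarrow> reduced x y \<Longrightarrow> reduced y x"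
  by (simp add: reduced_def gf_add_commute)

text \<open>The leading digit of \<open>y\<close> lies strictly above that of \<open>x\<close>:
  otherwise \<open>x < y\<close> would force both to share it, against
  \<open>reduced x y\<close>.\<close>

lemma reduced_gap:
  assumes "0 < x" "x < y" "reduced x y"
  obtains n where "x < 2 ^ n" "2 ^ n \<le> y"
proof -
  obtain n where n: "bit x n" "2 ^ n \<le> x" "x < 2 ^ Suc n" using top_bit assms(1) by blast
  have "\<not> bit y n" using reduced_iff[OF n(1,3)] assms(3) by simp
  then have "2 ^ Suc n \<le> y"
  proof (rule contrapos_np)
    assume "\<not> 2 ^ Suc n \<le> y"
    then have "y div 2 ^ n = 1" using n(2) assms(2) by (intro div_nat_eqI) auto
    then show "bit y n" by (simp add: bit_iff_odd)
  qed
  with n(3) show thesis by (rule that)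
qed

text \<open>\<open>reduced x\<close> depends only on the leading digit of \<open>x\<close>, and
  adding \<open>z\<close> leaves that digit in place.\<close>

lemma reduced_add_smaller:
  assumes "z < x" "reduced x z"
  shows "reduced (x \<oplus> z) y \<longleftrightarrow> reduced x y"
proof -
  obtain n where n: "bit x n" "2 ^ n \<le> x" "x < 2 ^ Suc n" using top_bit assms(1) by (metis gr0I not_less0)
  have "\<not> bit z n" using reduced_iff[OF n(1,3)] assms(2) by simp
  then have "bit (x \<oplus> z) n" using n(1) by (simp add: bit_gf_add)
  moreover have "x \<oplus> z < 2 ^ Suc n" using n(3) assms(1) by (intro gf_add_less_power) auto
  ultimately show ?thesis using reduced_iff n(1,3) by metis
qed

section \<open>Lines, planes and their reduced echelon bases\<close>

definition span2 :: "nat \<Rightarrow> nat \<Rightarrow> nat set" where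
  "span2 x y = {0, x, y, x \<oplus> y}"

definition span3 :: "nat \<Rightarrow> nat \<Rightarrow> nat \<Rightarrow> nat set" where
  "span3 x y z = {0, x, y, x \<oplus> y, z, x \<oplus> z, y \<oplus> z, x \<oplus> y \<oplus> z}"

definition canon2 :: "nat \<Rightarrow> nat \<Rightarrow> bool" where
  "canon2 x y \<longleftrightarrow> 0 < x \<and> x < y \<and> reduced x y \<and> y < 64"

definition canon3 :: "nat \<Rightarrow> nat \<Rightarrow> nat \<Rightarrow> bool" where
  "canon3 x y z \<longleftrightarrow> canon2 x y \<and> y < z \<and> reduced x z \<and> reduced y z \<and> z < 64"

lemma has_dim_span2:
  assumes "0 < x" "0 < y" "x \<noteq> y" "x < 64" "y < 64"
  shows "has_dim (span2 x y) 2"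
proof -
  have "card (span2 x y) = 4" using assms by (simp add: span2_def)
  moreover have "subspace2 (span2 x y)"
    using assms gf_add_less_64 by (auto simp: subspace2_def span2_def F64_def gf_add_ac)
  ultimately show ?thesis by (simp add: has_dim_def)
qed

lemma span3_conv_span2: "span3 x y z = span2 x y \<union> (\<oplus>) z ` span2 x y"
  by (auto simp: span3_def span2_def gf_add_ac)

lemma has_dim_span3:
  assumes "0 < x" "0 < y" "x \<noteq> y" "z \<notin> span2 x y" "x < 64" "y < 64" "z < 64"
  shows "has_dim (span3 x y z) 3"
proof -
  \<comment> \<open>The coset of \<open>z\<close> is disjoint from the line, so the plane has 4 + 4
    elements.\<close>
  have "t \<noteq> z \<oplus> s" if "t \<in> span2 x y" "s \<in> span2 x y" for t s
  proof
    assume "t = z \<oplus> s"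
    then have "z = s \<oplus> t" by (metis gf_add_cancel gf_add_commute)
    moreover have "s \<oplus> t \<in> span2 x y" using has_dim_span2[of x y] that assms
      by (auto simp: has_dim_def subspace2_def)
    ultimately show False using assms by simp
  qed
  then have "card (span2 x y \<union> (\<oplus>) z ` span2 x y) = card (span2 x y) + card ((\<oplus>) z ` span2 x y)"
    by (intro card_Un_disjoint) (blast | simp add: span2_def)+
  moreover have "card ((\<oplus>) z ` span2 x y) = card (span2 x y)"
    by (intro card_image inj_onI) simp
  moreover have "card (span2 x y) = 4" using assms by (simp add: span2_def)
  ultimately have "card (span3 x y z) = 8" by (simp add: span3_conv_span2)
  moreover have "subspace2 (span3 x y z)"
    using assms gf_add_less_64 by (auto simp: subspace2_def span3_def F64_def gf_add_ac)
  ultimately show ?thesis by (simp add: has_dim_def)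
qed

lemma canon2D:
  assumes "canon2 x y"
  shows "0 < x" "x < y" "y < x \<oplus> y" "reduced x y" "reduced y x" "x < 64" "y < 64"
  using assms reduced_swap by (auto simp: canon2_def reduced_def)

lemma canon3D:
  assumes "canon3 x y z"
  shows "canon2 x y" "x \<oplus> y < z" "z < x \<oplus> z" "x \<oplus> z < y \<oplus> (x \<oplus> z)"
    "reduced x z" "reduced y z" "reduced (x \<oplus> y) z" "y < z" "z < 64" "z < y \<oplus> z" "z \<notin> span2 x y"
proof -
  show 1: "canon2 x y" and 2: "reduced x z" "reduced y z" "y < z" "z < 64"
    using assms by (auto simp: canon3_def)
  note c = canon2D[OF 1]
  \<comment> \<open>A power of two separates \<open>y\<close> from \<open>z\<close>, and
    \<open>x \<oplus> y\<close> stays below it because \<open>x\<close> and \<open>y\<close>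
    do.\<close>
  from 2 c obtain n where "y < 2 ^ n" "2 ^ n \<le> z" using reduced_gap[of y z] by auto
  then show 3: "x \<oplus> y < z" using gf_add_less_power[of x n y] c by auto
  show 4: "z < x \<oplus> z" "z < y \<oplus> z" using 2 by (auto simp: reduced_def)
  show 5: "x \<oplus> z < y \<oplus> (x \<oplus> z)" using reduced_add[of y x z] 2 c by (simp add: reduced_def)
  then show "reduced (x \<oplus> y) z" using 4 by (simp add: reduced_def gf_add_ac)
  show "z \<notin> span2 x y" using 2 3 c by (auto simp: span2_def)
qed

section \<open>Recovering echelon bases from subspaces\<close>

definition key2 :: "nat set \<Rightarrow> nat \<times> nat" where
  "key2 U = (let x = Min (U - {0}) in (x, Min (U - {0, x})))"

text \<open>Taking greedy minima makes the echelon basis a function of the set alone, so that labels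
  can be attached to planes.\<close>

definition key3 :: "nat set \<Rightarrow> nat \<times> nat \<times> nat" where
  "key3 V = (let (x, y) = key2 V in (x, y, Min (V - span2 x y)))"

lemma key2_span2:
  assumes "canon2 x y"
  shows "key2 (span2 x y) = (x, y)"
proof -
  note c = canon2D[OF assms]
  have "Min (span2 x y - {0}) = x" using c by (intro Min_eqI) (auto simp: span2_def)
  moreover have "Min (span2 x y - {0, x}) = y" using c by (intro Min_eqI) (auto simp: span2_def)
  ultimately show ?thesis by (simp add: key2_def)
qed

lemma key3_span3:
  assumes "canon3 x y z"
  shows "key3 (span3 x y z) = (x, y, z)"
proof -
  note d = canon3D[OF assms] and c = canon2D[OF canon3D(1)[OF assms]]
  have less: "y < z" "z < x \<oplus> y \<oplus> z" using d by (auto simp: gf_add_ac)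
  have "Min (span3 x y z - {0}) = x" using c d less by (intro Min_eqI) (auto simp: span3_def)
  moreover have "Min (span3 x y z - {0, x}) = y" using c d less by (intro Min_eqI) (auto simp: span3_def)
  moreover have "Min (span3 x y z - span2 x y) = z"
    using c d less by (intro Min_eqI) (auto simp: span3_def span2_def)
  ultimately show ?thesis by (simp add: key3_def key2_def)
qed

section \<open>Existence of echelon bases\<close>

lemma has_dimD:
  assumes "has_dim V k"
  shows "finite V" "card V = 2 ^ k" "0 \<in> V" "V \<subseteq> F64" "\<And>x y. x \<in> V \<Longrightarrow> y \<in> V \<Longrightarrow> x \<oplus> y \<in> V"
    "\<And>x. x \<in> V \<Longrightarrow> x < 64"
  using assms finite_subset[of V F64] by (auto simp: has_dim_def subspace2_def F64_def)

lemma span2_subset: "has_dim V k \<Longrightarrow> x \<in> V \<Longrightarrow> y \<in> V \<Longrightarrow> span2 x y \<subseteq> V"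
  by (simp add: span2_def has_dimD(3,5))

lemma span3_subset: "has_dim V k \<Longrightarrow> x \<in> V \<Longrightarrow> y \<in> V \<Longrightarrow> z \<in> V \<Longrightarrow> span3 x y z \<subseteq> V"
  by (simp add: span3_def has_dimD(3,5))

lemma span3_eqI:
  assumes "has_dim V 3" "x \<in> V" "y \<in> V" "z \<in> V" "0 < x" "0 < y" "x \<noteq> y" "z \<notin> span2 x y"
  shows "V = span3 x y z"
proof -
  have "has_dim (span3 x y z) 3" using assms has_dimD(6)[OF assms(1)] by (intro has_dim_span3) auto
  then show ?thesis
    using card_subset_eq[OF has_dimD(1)[OF assms(1)] span3_subset[OF assms(1-4)]] assms(1)
    by (simp add: has_dim_def)
qed

lemma span2_eqI:
  assumes "has_dim V 2" "x \<in> V" "y \<in> V" "0 < x" "0 < y" "x \<noteq> y"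
  shows "V = span2 x y"
proof -
  have "has_dim (span2 x y) 2" using assms has_dimD(6)[OF assms(1)] by (intro has_dim_span2) auto
  then show ?thesis
    using card_subset_eq[OF has_dimD(1)[OF assms(1)] span2_subset[OF assms(1-3)]] assms(1)
    by (simp add: has_dim_def)
qed

text \<open>Adding a vector \<open>u\<close> of the line to \<open>z\<close> gives another candidate
  for the minimum, so \<open>z \<le> u \<oplus> z\<close>.\<close>

lemma Min_reduced:
  assumes "has_dim V k" "span2 x y \<subseteq> V" "u \<in> span2 x y" "0 < u" "z = Min (V - span2 x y)" "V \<noteq> span2 x y"
    "has_dim (span2 x y) 2"
  shows "reduced u z"
proof -
  have "finite (V - span2 x y)" "V - span2 x y \<noteq> {}" using assms has_dimD by auto
  then have z: "z \<in> V - span2 x y" "\<And>t. t \<in> V - span2 x y \<Longrightarrow> z \<le> t"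
    using assms(5) Min_in Min_le by auto
  have "u \<oplus> z \<in> V" using assms z has_dimD(5)[OF assms(1)] by auto
  moreover have "u \<oplus> z \<notin> span2 x y"
    using z assms(3) has_dimD(5)[OF assms(7), of u "u \<oplus> z"] by auto
  ultimately have "z \<le> u \<oplus> z" using z by auto
  then show ?thesis using \<open>0 < u\<close> by (auto simp: reduced_def le_less)
qed

text \<open>The two smallest nonzero vectors work, since their sum is a third one. The minimality of
  \<open>y\<close> in the last clause puts the third basis vector of a plane above \<open>y\<close>
  in \<open>obtain_span3\<close>.\<close>

lemma obtain_canon2:
  assumes "has_dim V k" "2 \<le> k"
  obtains x y where "canon2 x y" "x \<in> V" "y \<in> V" "\<And>t. t \<in> V \<Longrightarrow> t = 0 \<or> t = x \<or> y \<le> t"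
proof -
  note V = has_dimD[OF assms(1)]
  have four: "4 \<le> card V" using power_increasing[of 2 k "2::nat"] assms(2) V(2) by simp
  have ne: "V - A \<noteq> {}" if "finite A" "card A < 4" for A
    using four that card_mono[of A V] by auto
  define x where "x = Min (V - {0})"
  define y where "y = Min (V - {0, x})"
  have x: "x \<in> V - {0}" "\<And>t. t \<in> V - {0} \<Longrightarrow> x \<le> t"
    unfolding x_def using Min_in[of "V - {0}"] ne[of "{0}"] V(1) by auto
  have "card {0, x} < 4" by (simp add: card_insert_if)
  then have y: "y \<in> V - {0, x}" "\<And>t. t \<in> V - {0, x} \<Longrightarrow> y \<le> t"
    unfolding y_def using Min_in[of "V - {0, x}"] ne[of "{0, x}"] V(1) by auto
  have "x \<oplus> y \<in> V - {0, x}" using x(1) y(1) V(5)[of x y] by auto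
  then have "y \<le> x \<oplus> y" by (rule y(2))
  then have "reduced x y" using x by (auto simp: reduced_def le_less)
  moreover have "x < y" using x y by (auto simp: le_less)
  ultimately have "canon2 x y" using x y V(6) by (auto simp: canon2_def)
  with x y show thesis by (intro that) auto
qed

lemma obtain_span2:
  assumes "has_dim U 2"
  obtains x y where "canon2 x y" "U = span2 x y"
proof -
  obtain x y where xy: "canon2 x y" "x \<in> U" "y \<in> U" using obtain_canon2[OF assms order_refl] by metis
  with canon2D[OF xy(1)] have "U = span2 x y" by (intro span2_eqI assms) auto
  with xy show thesis by (intro that)
qed

lemma has_dim_canon2: "canon2 x y \<Longrightarrow> has_dim (span2 x y) 2"
  using canon2D[of x y] by (intro has_dim_span2) auto

lemma obtain_span3:
  assumes "has_dim V 3"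
  obtains x y z where "canon3 x y z" "V = span3 x y z"
proof -
  obtain x y where xy: "canon2 x y" "x \<in> V" "y \<in> V" "\<And>t. t \<in> V \<Longrightarrow> t = 0 \<or> t = x \<or> y \<le> t"
    using obtain_canon2[OF assms] by auto
  note c = canon2D[OF xy(1)] and V = has_dimD[OF assms] and s = has_dim_canon2[OF xy(1)]
  have sub: "span2 x y \<subseteq> V" using assms xy by (intro span2_subset) auto
  have ne: "V \<noteq> span2 x y" using V(2) has_dimD(2)[OF s] by auto
  define z where "z = Min (V - span2 x y)"
  have z: "z \<in> V" "z \<notin> span2 x y"
    using Min_in[of "V - span2 x y"] ne sub V(1) by (auto simp: z_def)
  have "reduced x z" "reduced y z"
    using Min_reduced[OF assms sub _ _ z_def ne s] c by (auto simp: span2_def)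
  moreover have "y < z" using xy(4)[OF z(1)] z(2) by (auto simp: span2_def le_less)
  ultimately have "canon3 x y z" using xy V(6) z by (auto simp: canon3_def)
  moreover have "V = span3 x y z" using xy z c by (intro span3_eqI assms) auto
  ultimately show thesis by (rule that)
qed

text \<open>The echelon basis of the plane spanned by a line with echelon basis \<open>(x, y)\<close> and a vector \<open>z\<close>
  that is already reduced modulo that line.\<close>

definition insert_reduced :: "nat \<Rightarrow> nat \<Rightarrow> nat \<Rightarrow> nat \<times> nat \<times> nat" where
  "insert_reduced x y z = (if y < z then (x, y, z) else if x < z then (x, z, min y (z \<oplus> y))
     else (z, min x (z \<oplus> x), min y (z \<oplus> y)))"

text \<open>Only basis vectors above \<open>z\<close> can contain its leading digit, so only these
  are replaced by the smaller of \<open>v\<close> and \<open>z \<oplus> v\<close>.\<close>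

lemma insert_reduced:
  assumes xy: "canon2 x y" and z: "0 < z" "z < 64" "reduced x z" "reduced y z"
    and pqr: "insert_reduced x y z = (p, q, r)"
  shows "canon3 p q r" "span3 p q r = span3 x y z"
proof -
  note c = canon2D[OF xy]
  have ne: "z \<noteq> x" "z \<noteq> y" using z by (auto simp: reduced_def)
  have less: "z < x \<oplus> z" "z < y \<oplus> z" using z by (auto simp: reduced_def)
  define x' y' where "x' = min x (z \<oplus> x)" and "y' = min y (z \<oplus> y)"
  have y': "y' \<le> y" "y' < 64" "reduced z y'" "reduced x y'"
    using c z reduced_min[of z y] reduced_add[of x z y] by (auto simp: y'_def min_def)
  have x': "x' \<le> x" "reduced z x'" using z reduced_min[of z x] by (auto simp: x'_def)
  consider "y < z" | "x < z" "z < y" | "z < x" using ne by linarith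
  then have "canon3 p q r \<and> span3 p q r = span3 x y z"
  proof cases
    case 1
    then show ?thesis using pqr xy z by (auto simp: insert_reduced_def canon3_def)
  next
    case 2
    then have "p = x" "q = z" "r = y'" using pqr by (auto simp: insert_reduced_def y'_def)
    moreover have "z < y'" using 2 less by (auto simp: y'_def gf_add_commute)
    moreover have "span3 x z y' = span3 x y z" by (auto simp: y'_def min_def span3_def gf_add_ac)
    ultimately show ?thesis using c y' 2 z by (auto simp: canon3_def canon2_def)
  next
    case 3
    then have p: "p = z" "q = x'" "r = y'" using pqr c by (auto simp: insert_reduced_def y'_def x'_def)
    have "reduced x' y'" using reduced_add_smaller[OF 3 z(3), of y'] y'
      by (auto simp: x'_def min_def gf_add_commute)
    moreover have "z < x'" using 3 less by (auto simp: x'_def gf_add_commute)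
    moreover have "x' < y'"
    proof -
      \<comment> \<open>Reduction by \<open>z\<close> keeps the gap between \<open>x\<close> and
        \<open>y\<close>: \<open>x' \<le> x\<close> stays below \<open>2 ^ n\<close>, and adding
        \<open>z\<close>, itself below \<open>2 ^ n\<close>, cannot bring \<open>y\<close> under
        it.\<close>
      obtain n where n: "x < 2 ^ n" "2 ^ n \<le> y" using reduced_gap[of x y] c by auto
      then have "2 ^ n \<le> z \<oplus> y" using gf_add_less_power[of z n "z \<oplus> y"] 3 by force
      then show ?thesis using n x' by (auto simp: y'_def)
    qed
    moreover have "span3 z x' y' = span3 x y z" by (auto simp: x'_def y'_def min_def span3_def gf_add_ac)
    ultimately show ?thesis using p x' y' z c by (auto simp: canon3_def canon2_def)
  qed
  then show "canon3 p q r" "span3 p q r = span3 x y z" by auto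
qed

lemma notin_span2_reduced:
  assumes xy: "canon2 x y" and z: "0 < z" "reduced x z" "reduced y z"
  shows "z \<notin> span2 x y"
  using canon2D[OF xy] z by (auto simp: span2_def reduced_def gf_add_ac)

section \<open>Incidence of lines and planes\<close>

definition lines_of :: "nat set \<Rightarrow> nat set set" where
  "lines_of V = {U. has_dim U 2 \<and> U \<subseteq> V}"

definition planes_over :: "nat set \<Rightarrow> nat set set" where
  "planes_over U = {W \<in> J263_vertices. U \<subseteq> W}"

text \<open>Each coset of the line has exactly one element reduced modulo \<open>x\<close> and
  \<open>y\<close>, and the nonzero cosets correspond to the planes over the line.\<close>

lemma planes_over_span2:
  assumes xy: "canon2 x y"
  shows "bij_betw (span3 x y) {z. 0 < z \<and> z < 64 \<and> reduced x z \<and> reduced y z} (planes_over (span2 x y))"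
proof -
  note c = canon2D[OF xy]
  have sub: "span2 x y \<subseteq> span3 x y z" "z \<in> span3 x y z" for z by (auto simp: span2_def span3_def)
  have "span3 x y z \<in> planes_over (span2 x y)" if z: "0 < z" "z < 64" "reduced x z" "reduced y z" for z
    using has_dim_span3[of x y z] notin_span2_reduced[OF xy z(1,3,4)] c z sub
    by (auto simp: planes_over_def J263_vertices_def)
  moreover have "W \<in> span3 x y ` {z. 0 < z \<and> z < 64 \<and> reduced x z \<and> reduced y z}"
    if W: "W \<in> planes_over (span2 x y)" for W
  proof -
    have V: "has_dim W 3" and s: "span2 x y \<subseteq> W" using W by (auto simp: planes_over_def J263_vertices_def)
    note s2 = has_dim_canon2[OF xy]
    have ne: "W \<noteq> span2 x y" using has_dimD(2)[OF V] has_dimD(2)[OF s2] by auto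
    define z where "z = Min (W - span2 x y)"
    have z: "z \<in> W" "z \<notin> span2 x y"
      using Min_in[of "W - span2 x y"] ne s has_dimD(1)[OF V] by (auto simp: z_def)
    have "reduced x z" "reduced y z" using Min_reduced[OF V s _ _ z_def ne s2] c by (auto simp: span2_def)
    moreover have "0 < z" using z by (auto simp: span2_def)
    moreover have "W = span3 x y z" using V s z c by (intro span3_eqI) (auto simp: span2_def)
    ultimately show ?thesis using has_dimD(6)[OF V z(1)] by auto
  qed
  moreover have "inj_on (span3 x y) {z. 0 < z \<and> z < 64 \<and> reduced x z \<and> reduced y z}"
  proof (rule inj_onI, clarify)
    fix z w assume z: "0 < z" "reduced x z" "reduced y z" and w: "0 < w" "reduced x w" "reduced y w"
      and eq: "span3 x y z = span3 x y w"
    have "w \<in> span3 x y z" using sub(2)[of w] eq by simp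
    \<comment> \<open>A nonzero vector reduced modulo \<open>x\<close> and \<open>y\<close> is not
      in the line; this excludes the first case and gives \<open>z \<oplus> w = 0\<close> in the
      second.\<close>
    then have "w \<in> span2 x y \<or> z \<oplus> w \<in> span2 x y" by (auto simp: span3_def span2_def gf_add_ac)
    then show "z = w"
      using notin_span2_reduced[OF xy w] notin_span2_reduced[OF xy _ reduced_add[OF z(2) w(2)] reduced_add[OF z(3) w(3)]]
      by (metis gf_add_eq_0_iff neq0_conv)
  qed
  ultimately show ?thesis by (auto simp: bij_betw_def)
qed

text \<open>\<open>P\<close> consists of echelon bases, so \<open>key2\<close> yields injectivity,
  and the counts through each line can later be looked up by basis. Surjectivity compares all pairs
  of vectors of the plane.\<close>

lemma lines_of_span3:
  assumes "canon3 x y z"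
  defines "P \<equiv> {(x, y), (x, z), (y, z), (x, y \<oplus> z), (y, x \<oplus> z), (x \<oplus> y, z), (x \<oplus> y, x \<oplus> z)}"
  shows "bij_betw (\<lambda>(p, q). span2 p q) P (lines_of (span3 x y z))" "card P = 7"
    "\<And>p q. (p, q) \<in> P \<Longrightarrow> canon2 p q"
proof -
  note d = canon3D[OF assms(1)] and c = canon2D[OF canon3D(1)[OF assms(1)]]
  have less: "0 < x" "x < y" "y < x \<oplus> y" "x \<oplus> y < z" "z < x \<oplus> z" "z < y \<oplus> z" "x < 64" "y < 64" "z < 64"
    using c d by auto
  have "reduced x (y \<oplus> z)" "reduced y (x \<oplus> z)" "reduced (x \<oplus> y) (x \<oplus> z)"
    using reduced_add[of x y z] reduced_add[of y x z] reduced_add[of "x \<oplus> y" x z] c d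
    by (auto simp: reduced_def gf_add_ac)
  with less c d gf_add_less_64 show canon: "canon2 p q" if "(p, q) \<in> P" for p q
    using that by (auto simp: canon2_def P_def)
  show "card P = 7" using less by (auto simp: P_def card_insert_if gf_add_ac)
  have "inj_on (\<lambda>(p, q). span2 p q) P"
    by (rule inj_on_inverseI[of _ key2]) (use canon key2_span2 in auto)
  moreover have "span2 p q \<in> lines_of (span3 x y z)" if "(p, q) \<in> P" for p q
    using has_dim_canon2[OF canon[OF that]] that
    by (auto simp: lines_of_def P_def span2_def span3_def gf_add_ac)
  moreover have "U \<in> (\<lambda>(p, q). span2 p q) ` P" if U: "U \<in> lines_of (span3 x y z)" for U
  proof -
    obtain p q where pq: "canon2 p q" "U = span2 p q" using U obtain_span2 by (auto simp: lines_of_def)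
    have m: "p \<in> span3 x y z" "q \<in> span3 x y z" using U pq by (auto simp: lines_of_def span2_def)
    have ne: "p \<noteq> 0" "q \<noteq> 0" "p \<noteq> q" using canon2D[OF pq(1)] by auto
    have "(\<lambda>(p, q). span2 p q) ` P = {span2 x y, span2 x z, span2 y z, span2 x (y \<oplus> z), span2 y (x \<oplus> z),
        span2 (x \<oplus> y) z, span2 (x \<oplus> y) (x \<oplus> z)}" by (simp add: P_def)
    moreover have "span2 p q \<in> {span2 x y, span2 x z, span2 y z, span2 x (y \<oplus> z), span2 y (x \<oplus> z),
        span2 (x \<oplus> y) z, span2 (x \<oplus> y) (x \<oplus> z)}"
      using m ne unfolding span3_def span2_def
      by (elim insertE emptyE; simp add: gf_add_ac insert_commute)
    ultimately show ?thesis using pq by simp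
  qed
  ultimately show "bij_betw (\<lambda>(p, q). span2 p q) P (lines_of (span3 x y z))"
    by (auto simp: bij_betw_def)
qed


section \<open>Counting neighbours\<close>

lemma finite_J263: "finite J263_vertices"
  by (rule finite_subset[of _ "Pow F64"])
    (auto simp: J263_vertices_def has_dim_def subspace2_def F64_def)

lemma finite_lines_of: "finite V \<Longrightarrow> finite (lines_of V)"
  by (rule finite_subset[of _ "Pow V"]) (auto simp: lines_of_def)

lemma finite_planes_over: "finite (planes_over U)"
  using finite_J263 by (simp add: planes_over_def)

lemma card_lines_of: "V \<in> J263_vertices \<Longrightarrow> card (lines_of V) = 7"
  using lines_of_span3 obtain_span3[of V] bij_betw_same_card by (metis J263_vertices_def mem_Collect_eq)

text \<open>A common vector outside the line would, together with the line, span both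
  planes.\<close>

lemma Int_eq_line:
  assumes VW: "V \<in> J263_vertices" "W \<in> J263_vertices" "V \<noteq> W" and U: "U \<in> lines_of V" "U \<subseteq> W"
  shows "V \<inter> W = U"
proof (rule ccontr)
  assume "V \<inter> W \<noteq> U"
  then obtain t where t: "t \<in> V" "t \<in> W" "t \<notin> U" using U by (auto simp: lines_of_def)
  have "has_dim U 2" using U by (simp add: lines_of_def)
  then obtain p q where pq: "canon2 p q" "U = span2 p q" by (rule obtain_span2)
  note c = canon2D[OF pq(1)]
  have "X = span3 p q t" if "X \<in> J263_vertices" "U \<subseteq> X" "t \<in> X" for X
    using that t c pq by (intro span3_eqI) (auto simp: J263_vertices_def span2_def)
  then have "V = span3 p q t" "W = span3 p q t" using VW U t by (auto simp: lines_of_def)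
  then show False using VW by simp
qed

lemma J263_adj_iff:
  assumes "V \<in> J263_vertices" "W \<in> J263_vertices"
  shows "J263_adj V W \<longleftrightarrow> W \<noteq> V \<and> (\<exists>U\<in>lines_of V. U \<subseteq> W)"
proof
  assume adj: "J263_adj V W"
  then have "has_dim (V \<inter> W) 2" by (simp add: J263_adj_def)
  moreover have "W \<noteq> V" using calculation assms by (auto simp: has_dim_def J263_vertices_def)
  ultimately show "W \<noteq> V \<and> (\<exists>U\<in>lines_of V. U \<subseteq> W)" by (auto simp: lines_of_def)
next
  assume "W \<noteq> V \<and> (\<exists>U\<in>lines_of V. U \<subseteq> W)"
  then obtain U where "W \<noteq> V" "U \<in> lines_of V" "U \<subseteq> W" by blast
  with Int_eq_line[OF assms] show "J263_adj V W" using assms by (auto simp: J263_adj_def lines_of_def)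
qed

text \<open>A neighbour of \<open>V\<close> shares exactly one line with it, the intersection, so
  the neighbours split into disjoint families indexed by the lines of \<open>V\<close>.\<close>

lemma card_neighbours:
  assumes V: "V \<in> J263_vertices" and D: "D \<subseteq> J263_vertices"
  shows "card {W \<in> D. J263_adj V W} = (\<Sum>U\<in>lines_of V. card {W \<in> D - {V}. U \<subseteq> W})"
proof -
  have fin: "finite D" using D finite_J263 finite_subset by blast
  have "{W \<in> D. J263_adj V W} = (\<Union>U\<in>lines_of V. {W \<in> D - {V}. U \<subseteq> W})"
    using J263_adj_iff[OF V] D by blast
  moreover have "{W \<in> D - {V}. U \<subseteq> W} \<inter> {W \<in> D - {V}. U' \<subseteq> W} = {}"
    if "U \<in> lines_of V" "U' \<in> lines_of V" "U \<noteq> U'" for U U'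
    using Int_eq_line[OF V] that D by blast
  moreover have "finite V" using V has_dimD(1) by (auto simp: J263_vertices_def)
  ultimately show ?thesis using fin finite_lines_of by (simp add: card_UN_disjoint)
qed

text \<open>The sets \<open>W - U\<close> partition the 60 vectors outside the line into blocks of
  4.\<close>

lemma card_planes_over:
  assumes U: "has_dim U 2"
  shows "card (planes_over U) = 15"
proof -
  obtain p q where pq: "canon2 p q" "U = span2 p q" using U by (rule obtain_span2)
  note c = canon2D[OF pq(1)]
  let ?C = "(\<lambda>W. W - U) ` planes_over U"
  have W: "W \<in> J263_vertices" "has_dim W 3" "U \<subseteq> W" if "W \<in> planes_over U" for W
    using that by (auto simp: planes_over_def J263_vertices_def)
  have union: "\<Union>?C = F64 - U"
  proof (intro equalityI subsetI)
    fix t assume t: "t \<in> F64 - U"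
    then have "has_dim (span3 p q t) 3" using pq c by (intro has_dim_span3) (auto simp: F64_def)
    moreover have "U \<subseteq> span3 p q t" "t \<in> span3 p q t" by (auto simp: pq span2_def span3_def)
    ultimately show "t \<in> \<Union>?C" using t by (auto simp: planes_over_def J263_vertices_def)
  qed (use W has_dimD(4) in blast)
  have "card (W - U) = 4" if "W \<in> planes_over U" for W
    using has_dimD(1,2)[OF U] has_dimD(2)[OF W(2)[OF that]] W(3)[OF that] by (simp add: card_Diff_subset)
  then have "card X = 4" if "X \<in> ?C" for X
    using that by blast
  moreover have "X \<inter> Y = {}" if XY: "X \<in> ?C" "Y \<in> ?C" "X \<noteq> Y" for X Y
  proof -
    obtain W1 W2 where 12: "W1 \<in> planes_over U" "W2 \<in> planes_over U" "X = W1 - U" "Y = W2 - U"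
      using XY by blast
    then have "W1 \<inter> W2 = U"
      using XY(3) U W(1,3) by (intro Int_eq_line) (auto simp: lines_of_def)
    then show ?thesis using 12 by blast
  qed
  moreover have "finite (F64 - U)" by (simp add: F64_def)
  ultimately have "4 * card ?C = card (F64 - U)"
    using card_partition[of ?C 4] finite_planes_over union by simp
  also have "\<dots> = 60"
    using has_dimD[OF U] by (simp add: card_Diff_subset F64_def)
  finally have "card ?C = 15" by simp
  moreover have "inj_on (\<lambda>W. W - U) (planes_over U)"
    using W(3) by (intro inj_onI) blast
  ultimately show ?thesis by (simp add: card_image)
qed

lemma CR1_codeI:
  assumes C: "C \<subseteq> J263_vertices" and g: "0 < g" "g < 93"
    and sum: "\<And>V. V \<in> J263_vertices \<Longrightarrow>
      (\<Sum>U\<in>lines_of V. \<Sum>W\<in>planes_over U. of_bool (W \<in> C)) = g + 12 * of_bool (V \<in> C)"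
  shows "CR1_code C (93 - g) g"
proof -
  have over: "{W \<in> C. U \<subseteq> W} = planes_over U \<inter> {W. W \<in> C}" for U
    using C by (auto simp: planes_over_def)
  have sum': "(\<Sum>U\<in>lines_of V. card {W \<in> C. U \<subseteq> W}) = g + 12 * of_bool (V \<in> C)"
    if "V \<in> J263_vertices" for V
    using sum[OF that] finite_planes_over by (simp add: over sum_of_bool_eq)
  \<comment> \<open>A concrete vertex \<open>V0\<close>; the positive sum at it makes
    \<open>C\<close> nonempty.\<close>
  have "has_dim (span3 1 2 4) 3" by (rule has_dim_span3) (auto simp: span2_def gf_add_def)
  then obtain V0 where V0: "V0 \<in> J263_vertices" by (auto simp: J263_vertices_def)
  have "C \<noteq> {}" using sum'[OF V0] g by auto
  \<comment> \<open>The value is 7 * 15 - (g + 12). The set difference with \<open>{V}\<close>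
    changes nothing for \<open>V \<in> C\<close>; it matches the form of
    \<open>card_neighbours\<close>.\<close>
  have compl: "(\<Sum>U\<in>lines_of V. card {W \<in> J263_vertices - C - {V}. U \<subseteq> W}) = 93 - g"
    if V: "V \<in> C" for V
  proof -
    have "card {W \<in> J263_vertices - C - {V}. U \<subseteq> W} + card {W \<in> C. U \<subseteq> W} = 15"
      if U: "U \<in> lines_of V" for U
    proof -
      have "planes_over U = {W \<in> J263_vertices - C - {V}. U \<subseteq> W} \<union> {W \<in> C. U \<subseteq> W}"
        using C V by (auto simp: planes_over_def)
      then have "card (planes_over U) = card {W \<in> J263_vertices - C - {V}. U \<subseteq> W} + card {W \<in> C. U \<subseteq> W}"
        using finite_planes_over[of U] by (subst card_Un_disjoint[symmetric]) (auto intro: finite_subset)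
      then show ?thesis using card_planes_over[of U] U by (simp add: lines_of_def)
    qed
    then have "(\<Sum>U\<in>lines_of V. card {W \<in> J263_vertices - C - {V}. U \<subseteq> W} + card {W \<in> C. U \<subseteq> W}) = 105"
      using card_lines_of[of V] V C by (simp add: subset_eq)
    then show ?thesis using sum'[of V] V C by (auto simp: sum.distrib)
  qed
  have "J263_vertices - C \<noteq> {}"
  proof
    assume *: "J263_vertices - C = {}"
    then have "V0 \<in> C" using V0 by blast
    \<comment> \<open>With an empty complement the sum in \<open>compl\<close> is 0, whereas
      \<open>93 - g\<close> is positive.\<close>
    from compl[OF this] show False using g by (simp add: *)
  qed
  moreover have "card {W \<in> J263_vertices - C. J263_adj V W} = 93 - g" if "V \<in> C" for V
    using card_neighbours[of V "J263_vertices - C"] compl[OF that] that C by auto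
  moreover have "card {W \<in> C. J263_adj V W} = g" if "V \<in> J263_vertices - C" for V
  proof -
    have "C - {V} = C" using that by auto
    then show ?thesis using card_neighbours[of V C] sum'[of V] that C by auto
  qed
  ultimately show ?thesis using C \<open>C \<noteq> {}\<close> by (simp add: CR1_code_def)
qed

section \<open>Multiplication and invariance\<close>

text \<open>Every step is additive in the accumulator and the source of digits together, so the
  induction carries two arbitrary accumulators.\<close>

lemma fold_xor_bits_add:
  "fold (\<lambda>i acc. if bit (x \<oplus> y) i then acc \<oplus> c i else acc) is (u \<oplus> v) =
   fold (\<lambda>i acc. if bit x i then acc \<oplus> c i else acc) is u \<oplus>
   fold (\<lambda>i acc. if bit y i then acc \<oplus> c i else acc) is v"
proof (induction "is" arbitrary: u v)
  case (Cons i "is")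
  have "(if bit (x \<oplus> y) i then u \<oplus> v \<oplus> c i else u \<oplus> v) =
    (if bit x i then u \<oplus> c i else u) \<oplus> (if bit y i then v \<oplus> c i else v)"
    by (simp add: bit_gf_add gf_add_ac)
  with Cons show ?case by simp
qed simp

text \<open>Here a digit of the accumulator itself decides each step; it is additive as well, by
  \<open>bit_gf_add\<close>.\<close>

lemma fold_reduce_add:
  "fold (\<lambda>i acc. if bit acc i then acc \<oplus> c i else acc) is (u \<oplus> v) =
   fold (\<lambda>i acc. if bit acc i then acc \<oplus> c i else acc) is u \<oplus>
   fold (\<lambda>i acc. if bit acc i then acc \<oplus> c i else acc) is v"
proof (induction "is" arbitrary: u v)
  case (Cons i "is")
  have "(if bit (u \<oplus> v) i then u \<oplus> v \<oplus> c i else u \<oplus> v) =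
    (if bit u i then u \<oplus> c i else u) \<oplus> (if bit v i then v \<oplus> c i else v)"
    by (simp add: bit_gf_add gf_add_ac)
  with Cons show ?case by simp
qed simp

lemma gf_mul_add: "gf_mul a (x \<oplus> y) = gf_mul a x \<oplus> gf_mul a y"
proof -
  have "clmul a x = fold (\<lambda>i acc. if bit x i then acc \<oplus> a * 2 ^ i else acc) [0..<6] 0" for x
    unfolding clmul_def gf_add_def ..
  then have "clmul a (x \<oplus> y) = clmul a x \<oplus> clmul a y"
    using fold_xor_bits_add[of x y "\<lambda>i. a * 2 ^ i" "[0..<6]" 0 0] by simp
  moreover have "gf_reduce p =
      fold (\<lambda>i acc. if bit acc i then acc \<oplus> 67 * 2 ^ (i - 6) else acc) (rev [6..<11]) p" for p
    unfolding gf_reduce_def gf_add_def ..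
  ultimately show ?thesis
    using fold_reduce_add[of "\<lambda>i. 67 * 2 ^ (i - 6)"] by (simp only: gf_mul_def)
qed

lemma gf_mul_0: "gf_mul a 0 = 0"
  using gf_mul_add[of a 0 0] by simp

section \<open>Gaussian elimination for two and three vectors\<close>

definition canonize2 :: "nat \<Rightarrow> nat \<Rightarrow> nat \<times> nat" where
  "canonize2 a b = (let b = min b (a \<oplus> b) in if a < b then (a, b) else (b, min a (b \<oplus> a)))"

text \<open>A field multiplication need not map an echelon basis to an echelon basis; elimination
  recovers the key under which the label of the image is stored.\<close>

definition canonize3 :: "nat \<Rightarrow> nat \<Rightarrow> nat \<Rightarrow> nat \<times> nat \<times> nat" where
  "canonize3 a b c = (let (x, y) = canonize2 a b; c = min c (y \<oplus> c) in insert_reduced x y (min c (x \<oplus> c)))"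

lemma canonize2:
  assumes "0 < a" "0 < b" "a \<noteq> b" "a < 64" "b < 64" "canonize2 a b = (x, y)"
  shows "canon2 x y" "span2 x y = span2 a b"
proof -
  define b' where "b' = min b (a \<oplus> b)"
  have eq: "(x, y) = (if a < b' then (a, b') else (b', min a (b' \<oplus> a)))"
    using assms(6) by (simp only: canonize2_def Let_def b'_def)
  have b': "reduced a b'" "0 < b'" "b' < 64" "span2 a b' = span2 a b"
    using assms reduced_min[of a b] gf_add_less_64[of a b]
    by (auto simp: b'_def min_def span2_def intro: gr0I)
  then have "a \<noteq> b'" using assms(1) by (auto simp: reduced_def)
  show "canon2 x y"
  proof (cases "a < b'")
    case True
    then show ?thesis using eq assms b' by (auto simp: canon2_def)
  next
    case False
    with \<open>a \<noteq> b'\<close> have "b' < a" by simp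
    moreover have "b' < b' \<oplus> a" using b' by (simp add: reduced_def gf_add_commute)
    moreover have "reduced b' (min a (b' \<oplus> a))" using reduced_min b' by simp
    ultimately show ?thesis using eq assms b' False
      by (auto simp: canon2_def)
  qed
  have "span2 x y = span2 a b'"
    using eq by (auto simp: min_def span2_def gf_add_ac split: if_splits)
  with b' show "span2 x y = span2 a b" by simp
qed

lemma canonize3:
  assumes ab: "0 < a" "0 < b" "a \<noteq> b" "a < 64" "b < 64" and c: "c \<notin> span2 a b" "c < 64"
    and "canonize3 a b c = (p, q, r)"
  shows "canon3 p q r" "span3 p q r = span3 a b c"
proof -
  obtain x y where xy: "canonize2 a b = (x, y)" by fastforce
  note can = canonize2[OF ab xy]
  note d = canon2D[OF can(1)]
  define c1 c2 where "c1 = min c (y \<oplus> c)" and "c2 = min c1 (x \<oplus> c1)"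
  have "span3 x y c2 = span3 x y c"
    by (auto simp: c1_def c2_def min_def span3_def gf_add_ac)
  then have span: "span3 x y c2 = span3 a b c" using can(2) by (simp add: span3_conv_span2)
  have "reduced y c1" "reduced x c2" using d reduced_min by (auto simp: c1_def c2_def)
  \<comment> \<open>Reducing by \<open>x\<close> cannot undo the reduction by \<open>y\<close>,
    because \<open>x\<close> itself is reduced modulo \<open>y\<close>.\<close>
  moreover have "reduced y c2" using \<open>reduced y c1\<close> reduced_add[of y x c1] d
    by (auto simp: c2_def min_def)
  moreover have "c2 \<noteq> 0"
  proof
    assume "c2 = 0"
    then have "c \<in> span2 x y" by (auto simp: c2_def c1_def min_def span2_def gf_add_ac split: if_splits)
    then show False using c can by simp
  qed
  moreover have "c2 < 64" using c d gf_add_less_64 by (auto simp: c2_def c1_def min_def)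
  moreover have "insert_reduced x y c2 = (p, q, r)"
    using assms(8) by (simp add: canonize3_def xy Let_def c1_def c2_def)
  ultimately show "canon3 p q r" "span3 p q r = span3 a b c"
    using insert_reduced[OF can(1), of c2 p q r] span by auto
qed

lemma invariant_under_Gamma21I:
  assumes C: "\<And>V. V \<in> C \<Longrightarrow> V \<subseteq> F64" "\<And>V. V \<in> C \<Longrightarrow> gf_mul (gf_pow a 21) ` V \<in> C"
  shows "invariant_under C (Gamma21 a)"
proof -
  have "(gf_mul (gf_pow a 21) ^^ k) ` V \<in> C" if "V \<in> C" for k V
  proof (induction k)
    case (Suc k)
    then show ?case using C(2)[OF Suc] by (simp add: image_image)
  qed (simp add: that)
  then show ?thesis by (auto simp: invariant_under_def Gamma21_def)
qed
section \<open>The codes\<close>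

definition vecs :: "nat list" where
  "vecs = [1..<64]"

definition coset_mins :: "nat \<Rightarrow> nat \<Rightarrow> nat list" where
  "coset_mins x y = filter (\<lambda>z. reduced x z \<and> reduced y z) vecs"

definition canon_lines :: "(nat \<times> nat) list" where
  "canon_lines = concat (map (\<lambda>x. map (Pair x) (filter (\<lambda>y. x < y \<and> reduced x y) vecs)) vecs)"

definition canon_planes :: "(nat \<times> nat \<times> nat) list" where
  "canon_planes = concat (map (\<lambda>(x, y). map (\<lambda>z. (x, y, z)) (filter ((<) y) (coset_mins x y))) canon_lines)"

text \<open>The labels of the planes, in the order of \<open>canon_planes\<close>. The planes with label 1 or 5 form the
  code for 12, label 2 gives the code for 15, label 3 the one for 18, and labels 4 and 5 the one
  for 24; so label 5 marks the intersection of the first and the last code.\<close>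

definition labels :: "nat list" where
  "labels = concat [
   [3,3,4,3,2,3,3,3,3,2,3,3,5,4,2,0,2,0,4,4,0,3,3,1,2,2,0,2,4,0,5,2,1,1,5,5,0,0,2,2,0,3,4,2,3],
   [0,0,4,5,0,0,3,4,0,0,2,3,4,3,2,3,4,0,4,3,0,1,4,0,0,4,2,5,5,0,2,4,0,4,0,0,0,0,2,0,2,0,0,0,4],
   [5,0,5,0,0,3,4,4,2,0,1,1,0,4,0,4,0,2,0,4,0,1,2,2,4,0,0,3,0,5,2,4,3,3,4,0,0,1,4,0,1,4,3,3,4],
   [3,2,2,0,0,3,3,4,0,2,3,0,0,1,4,3,0,0,3,4,3,0,3,0,4,4,0,3,3,0,4,4,0,2,1,0,4,0,1,0,4,3,0,0,4],
   [3,0,0,2,2,2,0,2,4,5,0,0,1,5,5,3,3,4,0,0,4,0,0,0,0,0,4,3,0,0,0,3,2,0,2,0,0,0,5,2,0,3,0,2,1],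
   [1,3,2,3,5,5,4,1,5,4,0,0,3,2,0,0,5,3,0,0,4,4,4,4,0,3,4,2,0,0,4,2,0,4,2,1,1,2,0,2,0,2,0,4,5],
   [4,0,0,4,3,3,0,5,3,0,2,0,2,4,4,0,4,2,0,1,2,4,2,3,3,3,4,2,1,1,4,4,3,0,0,2,2,2,0,4,0,3,4,0,5],
   [3,0,3,0,0,3,4,0,3,2,5,3,3,4,0,0,0,0,0,3,2,3,2,0,4,0,4,0,2,5,0,1,0,3,0,0,3,0,0,2,2,0,0,5,4],
   [4,4,4,4,4,4,4,4,4,4,4,0,5,3,2,4,0,4,3,1,0,1,0,0,0,0,4,0,2,2,2,2,2,0,2,3,0,0,5,5,1,0,5,0,0],
   [0,4,4,1,0,1,0,4,2,0,2,0,0,3,1,0,5,0,0,0,3,0,3,0,2,2,3,2,5,3,3,4,3,0,3,5,3,3,2,3,3,0,4,0,2],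
   [0,0,1,1,4,2,2,0,2,0,0,3,4,4,3,3,0,5,3,0,1,4,0,4,3,2,3,0,0,2,0,4,2,4,3,4,0,0,0,3,3,0,5,0,0],
   [1,5,0,1,0,1,5,0,5,1,0,0,0,3,2,2,4,1,3,2,0,3,3,2,5,0,0,4,4,4,4,4,4,5,4,4,0,3,0,2,0,0,4,4,0],
   [1,4,2,2,0,0,2,0,2,4,0,1,4,1,3,0,3,3,0,0,0,4,0,2,0,0,5,2,0,0,0,0,0,4,2,2,5,0,3,1,3,5,5,2,5],
   [4,2,2,2,2,2,2,0,2,0,4,3,4,3,5,3,1,3,3,0,0,3,4,0,0,3,4,4,4,4,4,4,4,4,0,3,3,2,5,4,0,4,2,0,0],
   [2,1,2,1,4,0,4,2,3,3,0,0,2,1,3,5,3,3,3,0,3,0,0,2,4,0,2,5,0,2,2,5,0,2,4,2,0,0,0,4,3,2,0,3,4],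
   [2,0,0,4,4,4,3,2,2,4,3,0,3,0,2,4,3,0,0,5,0,5,5,3,1,1,0,0,0,3,0,0,0,0,2,0,2,0,3,3,0,0,2,0,2],
   [3,3,4,5,1,0,0,3,0,0,3,2,3,0,4,3,3,4,5,0,2,0,2,0,4,5,4,1,5,2,0,2,0,3,3,5,5,2,4,2,4,4,4,4,0],
   [0,0,0,0,2,3,0,2,0,1,4,4,0,0,3,4,0,3,1,3,3,1,4,3,0,4,3,3,3,0,0,2,2,0,4,0,0,4,3,2,3,0,5,5,3],
   [5,5,2,4,4,2,3,4,0,4,2,4,0,3,0,3,0,4,3,0,2,4,3,4,0,4,2,4,2,0,3,2,0,5,2,2,0,0,0,0,4,5,3,0,2],
   [3,2,0,4,4,3,0,0,4,0,3,0,5,0,3,0,0,0,3,2,5,4,0,3,0,0,2,2,0,4,5,4,4,0,2,0,2,4,2,2,2,4,2,2,2],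
   [4,0,0,2,0,4,0,0,4,1,0,4,1,4,3,5,4,2,3,0,0,2,1,3,4,0,3,0,5,0,0,4,4,5,3,2,1,0,4,0,4,3,0,3,0],
   [0,3,0,5,5,5,3,0,1,2,3,3,4,5,4,0,3,0,3,2,3,5,3,2,4,3,2,3,5,4,3,4,2,3,2,0,3,4,3,2,1,2,3,0,0],
   [4,4,4,2,0,0,4,0,4,3,2,3,4,0,0,1,5,2,1,5,2,0,0,2,0,2,0,0,0,0,0,2,3,5,0,4,4,0,4,3,2,5,0,4,0],
   [0,4,2,0,5,0,4,3,4,3,0,0,4,4,0,2,0,0,0,3,4,4,3,4,0,0,2,3,2,0,3,0,3,0,3,0,5,3,0,3,0,1,4,0,0],
   [0,4,2,1,0,3,2,2,0,4,1,0,0,0,0,0,0,0,0,4,3,3,2,3,3,2,4,5,4,4,4,4,4,4,5,3,2,3,3,4,4,2,2,3,0],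
   [0,4,0,0,1,0,1,3,3,0,3,0,0,1,3,0,2,5,0,4,3,0,3,4,4,5,5,2,0,3,3,2,3,5,3,2,0,3,4,0,0,2,0,2,0],
   [0,0,2,3,0,0,2,0,4,3,2,0,3,0,5,0,0,3,0,0,4,2,5,0,0,0,2,5,0,4,5,4,2,3,0,5,0,0,0,0,3,4,0,2,2],
   [3,0,3,0,2,2,2,2,2,2,0,0,0,4,5,0,3,0,0,3,3,0,0,3,0,3,3,3,2,2,3,2,3,5,4,0,0,2,0,0,3,5,4,3,3],
   [0,3,0,3,3,0,3,0,5,5,1,5,3,0,2,0,3,3,4,3,0,3,3,0,0,3,0,0,0,4,3,0,0,4,1,1,2,2,2,5,3,0,0,0,3],
   [0,1,3,2,2,2,0,5,4,3,0,3,4,2,0,4,5,0,1,3,3,0,3,0,0,1,2,0,4,3,3,0,4,4,4,0,4,1,1,3,3,4,2,0,3],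
   [0,5,2,2,0,2,0,0,4,5,4,2,3,3,1,4,0,3,3,4,3,2,3,4,4,0,4,3,0,4,5,3,0,2,3,1,4,3,5,0,0,4,3,0,0]]"

definition label :: "nat \<times> nat \<times> nat \<Rightarrow> nat" where
  "label p = the (map_of (zip canon_planes labels) p)"

text \<open>Digit \<open>i\<close> in base 1000 is the indicator of the \<open>i\<close>-th code.\<close>

definition weight :: "nat \<Rightarrow> nat" where
  "weight e = of_bool (e \<in> {1, 5}) + 1000 * (of_bool (e \<in> {2}) +
     1000 * (of_bool (e \<in> {3}) + 1000 * of_bool (e \<in> {4, 5})))"

text \<open>The numbers of planes of each code through the line with echelon basis
  \<open>(x, y)\<close>, packed as in \<open>weight\<close>.\<close>

definition degree :: "nat \<Rightarrow> nat \<Rightarrow> nat" where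
  "degree x y = (\<Sum>z\<leftarrow>coset_mins x y. weight (label (insert_reduced x y z)))"

lemma set_vecs: "set vecs = {x. 0 < x \<and> x < 64}"
  by (auto simp: vecs_def)

lemma set_coset_mins: "set (coset_mins x y) = {z. 0 < z \<and> z < 64 \<and> reduced x z \<and> reduced y z}"
  by (auto simp: coset_mins_def set_vecs)

lemma distinct_coset_mins: "distinct (coset_mins x y)"
  by (simp add: coset_mins_def vecs_def)

lemma set_canon_lines: "set canon_lines = {(x, y). canon2 x y}"
  by (auto simp: canon_lines_def set_vecs canon2_def)

lemma set_canon_planes: "set canon_planes = {(x, y, z). canon3 x y z}"
proof -
  have "p \<in> set canon_planes \<longleftrightarrow> (\<exists>x y z. p = (x, y, z) \<and> canon2 x y \<and> y < z \<and> z \<in> set (coset_mins x y))" for p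
    by (auto simp: canon_planes_def set_canon_lines)
  then show ?thesis by (auto simp: canon3_def set_coset_mins)
qed

text \<open>Without repeated keys, the lookup in \<open>label\<close> returns the entry at the same
  position, as \<open>map_label\<close> requires.\<close>

lemma distinct_canon_planes: "distinct canon_planes"
proof -
  have 1: "distinct (concat (map (\<lambda>x. map (Pair x) (f x)) xs))"
    if "distinct xs" "\<And>x. distinct (f x)" for f :: "nat \<Rightarrow> nat list" and xs
    using that by (induction xs) (auto simp: distinct_map inj_on_def)
  have 2: "distinct (concat (map (\<lambda>(x, y). map (\<lambda>z. (x, y, z)) (f x y)) xs))"
    if "distinct xs" "\<And>x y. distinct (f x y)"
    for f :: "nat \<Rightarrow> nat \<Rightarrow> nat list" and xs :: "(nat \<times> nat) list"
    using that by (induction xs) (auto simp: distinct_map inj_on_def)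
  show ?thesis
    unfolding canon_planes_def canon_lines_def
    by (intro 2 1) (simp_all add: vecs_def distinct_coset_mins)
qed

section \<open>Verification by rewriting\<close>

text \<open>Appends a binary digit. The rules in \<open>double_plus_eval\<close> keep results in
  numeral form; 0 and 1 are treated apart because they are not of the form
  \<open>numeral k\<close>.\<close>

definition double_plus :: "bool \<Rightarrow> nat \<Rightarrow> nat" where
  "double_plus b n = 2 * n + of_bool b"

lemma double_plus_eval:
  "double_plus False 0 = 0" "double_plus False 1 = 2"
  "double_plus False (numeral k) = numeral (num.Bit0 k)"
  "double_plus True 0 = 1" "double_plus True 1 = 3"
  "double_plus True (numeral k) = numeral (num.Bit1 k)"
  by (simp_all add: double_plus_def)

lemma gf_add_double_plus:
  "(2 * m + of_bool a) \<oplus> (2 * n + of_bool b) = double_plus (a \<noteq> b) (m \<oplus> n)"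
  unfolding gf_add_def double_plus_def by (subst xor_rec) (auto simp: of_bool_def)

lemma gf_add_eval:
  "0 \<oplus> v = v" "v \<oplus> 0 = v" "1 \<oplus> 1 = 0"
  "1 \<oplus> numeral (num.Bit0 n) = numeral (num.Bit1 n)"
  "1 \<oplus> numeral (num.Bit1 n) = numeral (num.Bit0 n)"
  "numeral (num.Bit0 m) \<oplus> 1 = numeral (num.Bit1 m)"
  "numeral (num.Bit1 m) \<oplus> 1 = numeral (num.Bit0 m)"
  "numeral (num.Bit0 m) \<oplus> numeral (num.Bit0 n) = double_plus False (numeral m \<oplus> numeral n)"
  "numeral (num.Bit0 m) \<oplus> numeral (num.Bit1 n) = double_plus True (numeral m \<oplus> numeral n)"
  "numeral (num.Bit1 m) \<oplus> numeral (num.Bit0 n) = double_plus True (numeral m \<oplus> numeral n)"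
  "numeral (num.Bit1 m) \<oplus> numeral (num.Bit1 n) = double_plus False (numeral m \<oplus> numeral n)"
proof -
  note [simp del] = One_nat_def
  show "1 \<oplus> numeral (num.Bit0 n) = numeral (num.Bit1 n)"
    using gf_add_double_plus[of 0 True "numeral n" False] by (simp add: double_plus_def)
  show "1 \<oplus> numeral (num.Bit1 n) = numeral (num.Bit0 n)"
    using gf_add_double_plus[of 0 True "numeral n" True] by (simp add: double_plus_def)
  show "numeral (num.Bit0 m) \<oplus> 1 = numeral (num.Bit1 m)"
    using gf_add_double_plus[of "numeral m" False 0 True] by (simp add: double_plus_def)
  show "numeral (num.Bit1 m) \<oplus> 1 = numeral (num.Bit0 m)"
    using gf_add_double_plus[of "numeral m" True 0 True] by (simp add: double_plus_def)
  show "numeral (num.Bit0 m) \<oplus> numeral (num.Bit0 n) = double_plus False (numeral m \<oplus> numeral n)"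
    using gf_add_double_plus[of "numeral m" False "numeral n" False] by simp
  show "numeral (num.Bit0 m) \<oplus> numeral (num.Bit1 n) = double_plus True (numeral m \<oplus> numeral n)"
    using gf_add_double_plus[of "numeral m" False "numeral n" True] by simp
  show "numeral (num.Bit1 m) \<oplus> numeral (num.Bit0 n) = double_plus True (numeral m \<oplus> numeral n)"
    using gf_add_double_plus[of "numeral m" True "numeral n" False] by simp
  show "numeral (num.Bit1 m) \<oplus> numeral (num.Bit1 n) = double_plus False (numeral m \<oplus> numeral n)"
    using gf_add_double_plus[of "numeral m" True "numeral n" True] by simp
qed simp_all

text \<open>Stands in for \<open>if\<close>: the rewriting below has no congruence rules, hence normalizes both branches
  of an \<open>if\<close>, and unfolding \<open>filter\<close> with an \<open>if\<close> would then double the work at every element.\<close>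

definition select :: "bool \<Rightarrow> 'a \<Rightarrow> 'a \<Rightarrow> 'a" where
  "select b x y = (if b then x else y)"

lemma select_eval: "select True x y = x" "select False x y = y"
  by (simp_all add: select_def)

lemma filter_eval:
  "filter P [] = []" "filter P (x # xs) = select (P x) ((#) x) id (filter P xs)"
  by (simp_all add: select_def)

lemma min_eval: "min (a :: nat) b = select (a < b) a b"
  by (simp add: select_def)

lemma insert_reduced_eval:
  "insert_reduced x y z = select (y < z) (x, y, z) (select (x < z) (x, z, min y (z \<oplus> y))
     (z, min x (z \<oplus> x), min y (z \<oplus> y)))"
  by (simp add: insert_reduced_def select_def)

lemma canonize2_eval:
  "canonize2 a b = (let b = min b (a \<oplus> b) in select (a < b) (a, b) (b, min a (b \<oplus> a)))"
  by (simp add: canonize2_def select_def)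

lemma weight_eval:
  "weight 0 = 0" "weight 1 = 1" "weight 2 = 1000" "weight 3 = 1000000" "weight 4 = 1000000000"
  "weight 5 = 1000000001"
  by (simp_all add: weight_def)

lemma vecs_eval:
  "vecs =
    [1, 2, 3, 4, 5, 6, 7, 8, 9, 10, 11, 12, 13, 14, 15, 16, 17, 18, 19, 20, 21, 22, 23,
     24, 25, 26, 27, 28, 29, 30, 31, 32, 33, 34, 35, 36, 37, 38, 39, 40, 41, 42, 43, 44,
     45, 46, 47, 48, 49, 50, 51, 52, 53, 54, 55, 56, 57, 58, 59, 60, 61, 62, 63]"
proof -
  note [simp del] = One_nat_def
  show ?thesis by (simp add: vecs_def upt_conv_Cons)
qed

lemmas list_eval = list.map filter_eval select_eval id_apply concat.simps append.simps prod.case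
lemmas num_eval = rel_simps numeral_One gf_add_eval double_plus_eval reduced_def simp_thms
lemmas sum_eval = arith_simps sum_list.Nil sum_list.Cons add_num_simps one_plus_numeral
  numeral_plus_one one_add_one

section \<open>Explicit tables of lines, planes, labels and degrees\<close>

lemmas canon_lines_eval = canon_lines_def[simplified vecs_eval list_eval num_eval]

text \<open>Only the right side is unfolded. Once \<open>canon_lines\<close> is explicit,
  \<open>list.inject\<close> splits this list equation into one rewrite rule per line. The tables
  for \<open>label\<close> and \<open>degree\<close> arise in the same way.\<close>

lemma map_coset_mins:
  "map (\<lambda>(x, y). coset_mins x y) canon_lines =
   map (\<lambda>(x, y). filter (\<lambda>z. reduced x z \<and> reduced y z) vecs) canon_lines"
  unfolding coset_mins_def ..

lemmas coset_mins_eval =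
  map_coset_mins[unfolded canon_lines_eval vecs_eval, simplified list_eval num_eval list.inject]

lemmas canon_planes_eval =
  canon_planes_def[unfolded canon_lines_eval, simplified list_eval num_eval coset_mins_eval]

lemma length_labels: "length canon_planes = length labels"
  by (simp only: canon_planes_eval labels_def list.size list_eval)

text \<open>Comparing positions replaces evaluating the association list at every plane.\<close>

lemma map_label: "map label canon_planes = labels"
  by (rule nth_equalityI)
    (simp_all add: length_labels label_def map_of_zip_nth distinct_canon_planes)

lemmas label_eval = map_label[unfolded canon_planes_eval labels_def, simplified list_eval list.inject simp_thms]

lemma map_degree:
  "map (\<lambda>(x, y). degree x y) canon_lines =
   map (\<lambda>(x, y). \<Sum>z\<leftarrow>coset_mins x y. weight (label (insert_reduced x y z))) canon_lines"
  unfolding degree_def ..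

lemmas degree_eval = map_degree[unfolded canon_lines_eval, simplified list_eval list.inject num_eval
  coset_mins_eval label_eval weight_eval insert_reduced_eval min_eval sum_eval]

text \<open>The arguments are the seven echelon bases from \<open>lines_of_span3\<close>, so for an
  explicit plane every summand is found in \<open>degree_eval\<close>.\<close>

definition plane_sum :: "nat \<Rightarrow> nat \<Rightarrow> nat \<Rightarrow> nat" where
  "plane_sum x y z = degree x y + (degree x z + (degree y z + (degree x (y \<oplus> z) +
     (degree y (x \<oplus> z) + (degree (x \<oplus> y) z + degree (x \<oplus> y) (x \<oplus> z))))))"

text \<open>The digits 24, 18, 15, 12 in base 1000 are the parameters of the four codes.\<close>

lemma plane_sum:
  assumes "canon3 x y z"
  shows "plane_sum x y z = 24018015012 + 12 * weight (label (x, y, z))"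
proof -
  have "list_all (\<lambda>(x, y, z). plane_sum x y z = 24018015012 + 12 * weight (label (x, y, z))) canon_planes"
    by (simp only: canon_planes_eval list.pred_inject prod.case plane_sum_def degree_eval label_eval
        weight_eval num_eval sum_eval)
  then show ?thesis using assms set_canon_planes by (auto simp: list_all_iff)
qed

section \<open>Field multiplication by rewriting and invariance of the labels\<close>

definition add_if :: "bool \<Rightarrow> nat \<Rightarrow> nat \<Rightarrow> nat" where
  "add_if b x y = (if b then x \<oplus> y else x)"

text \<open>Naming the step lets the running value occur only once in \<open>gf_reduce_eval\<close>;
  unfolded symbolically, it would be duplicated at every step.\<close>

definition reduce_bit :: "nat \<Rightarrow> nat \<Rightarrow> nat \<Rightarrow> nat" where
  "reduce_bit x i y = add_if (bit x i) x y"

lemma bit_eval: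
  "bit (0 :: nat) n = False" "bit (1 :: nat) 0 = True" "bit (1 :: nat) (Suc n) = False"
  "bit (numeral (num.Bit0 m) :: nat) 0 = False" "bit (numeral (num.Bit1 m) :: nat) 0 = True"
  "bit (numeral (num.Bit0 m) :: nat) (Suc n) = bit (numeral m :: nat) n"
  "bit (numeral (num.Bit1 m) :: nat) (Suc n) = bit (numeral m :: nat) n"
  by (simp_all add: bit_Suc bit_1_iff bit_0)

lemma add_if_eval: "add_if True x y = x \<oplus> y" "add_if False x y = x"
  by (simp_all add: add_if_def)

text \<open>Digit positions are unary so that \<open>bit_eval\<close> can peel off one digit at a
  time; shifts are iterated doublings.\<close>

lemma clmul_eval:
  "clmul x y =
     add_if (bit y (Suc (Suc (Suc (Suc (Suc 0)))))) (add_if (bit y (Suc (Suc (Suc (Suc 0)))))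
    (add_if (bit y (Suc (Suc (Suc 0)))) (add_if (bit y (Suc (Suc 0)))
    (add_if (bit y (Suc 0)) (add_if (bit y 0) 0 x)
     (double_plus False x))
     (double_plus False (double_plus False x)))
     (double_plus False (double_plus False (double_plus False x))))
     (double_plus False (double_plus False (double_plus False (double_plus False x)))))
     (double_plus False (double_plus False (double_plus False (double_plus False (double_plus False x)))))"
proof -
  have "[0..<6] = [0, 1, 2, 3, 4, 5]" by (simp add: upt_conv_Cons)
  then have "[0..<6] = [0, Suc 0, Suc (Suc 0), Suc (Suc (Suc 0)), Suc (Suc (Suc (Suc 0))),
      Suc (Suc (Suc (Suc (Suc 0))))]"
    by (simp only: eval_nat_numeral One_nat_def BitM.simps)
  moreover have "clmul x y = fold (\<lambda>i acc. add_if (bit y i) acc (x * 2 ^ i)) [0..<6] 0"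
    unfolding clmul_def add_if_def gf_add_def ..
  moreover have "x * 2 ^ 0 = x" "x * 2 ^ Suc n = double_plus False (x * 2 ^ n)" for n
    by (simp_all add: double_plus_def)
  ultimately show ?thesis by (simp only: fold_simps)
qed

text \<open>The constants are 67 shifted by 4, 3, 2, 1 and 0 places, clearing digits 10 down to
  6.\<close>

lemma gf_reduce_eval:
  "gf_reduce p = reduce_bit (reduce_bit (reduce_bit (reduce_bit (reduce_bit p
     (Suc (Suc (Suc (Suc (Suc (Suc (Suc (Suc (Suc (Suc 0)))))))))) 1072)
     (Suc (Suc (Suc (Suc (Suc (Suc (Suc (Suc (Suc 0))))))))) 536)
     (Suc (Suc (Suc (Suc (Suc (Suc (Suc (Suc 0)))))))) 268)
     (Suc (Suc (Suc (Suc (Suc (Suc (Suc 0))))))) 134)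
     (Suc (Suc (Suc (Suc (Suc (Suc 0)))))) 67"
proof -
  have "[6..<11] = [6, 7, 8, 9, 10]" by (simp add: upt_conv_Cons)
  then have "rev [6..<11] = [Suc (Suc (Suc (Suc (Suc (Suc (Suc (Suc (Suc (Suc 0))))))))),
      Suc (Suc (Suc (Suc (Suc (Suc (Suc (Suc (Suc 0)))))))), Suc (Suc (Suc (Suc (Suc (Suc (Suc (Suc 0))))))),
      Suc (Suc (Suc (Suc (Suc (Suc (Suc 0)))))), Suc (Suc (Suc (Suc (Suc (Suc 0)))))]"
    by (simp only: rev.simps append.simps eval_nat_numeral One_nat_def BitM.simps)
  moreover have "gf_reduce p = fold (\<lambda>i acc. reduce_bit acc i (67 * 2 ^ (i - 6))) (rev [6..<11]) p"
    unfolding gf_reduce_def reduce_bit_def add_if_def gf_add_def ..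
  moreover have "67 * 2 ^ (Suc (Suc (Suc (Suc (Suc (Suc n))))) - 6) = 67 * (2 :: nat) ^ n" for n
    by simp
  moreover have "67 * 2 ^ 0 = (67 :: nat)" "67 * 2 ^ Suc 0 = (134 :: nat)"
    "67 * 2 ^ Suc (Suc 0) = (268 :: nat)" "67 * 2 ^ Suc (Suc (Suc 0)) = (536 :: nat)"
    "67 * 2 ^ Suc (Suc (Suc (Suc 0))) = (1072 :: nat)"
    by simp_all
  ultimately show ?thesis by (simp only: fold_simps)
qed

lemmas gf_mul_eval = gf_mul_def clmul_eval gf_reduce_eval reduce_bit_def add_if_eval bit_eval

lemma gf_pow_21:
  "gf_pow a 21 = (let f = gf_mul a
     in f (f (f (f (f (f (f (f (f (f (f (f (f (f (f (f (f (f (f (f (f 1)))))))))))))))))))))"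
  by (simp only: gf_pow_def Let_def eval_nat_numeral BitM.simps One_nat_def funpow.simps o_apply id_apply)

text \<open>The nontrivial cube roots of unity are 59 and its square 58. The predicates \<open>..._ok\<close> keep the
  simplifier from unfolding products of a bound variable, whose size explodes.\<close>

definition cube_root_of_1 :: "nat \<Rightarrow> bool" where
  "cube_root_of_1 v \<longleftrightarrow> v = 1 \<or> v = 58 \<or> v = 59"

definition gf_pow_21_ok :: "nat \<Rightarrow> bool" where
  "gf_pow_21_ok a \<longleftrightarrow> cube_root_of_1 (gf_pow a 21)"

text \<open>Evaluation at all 63 nonzero elements shows that \<open>gf_pow a 21\<close> is a cube
  root of unity; primitivity excludes the value 1, as 21 < 63.\<close>

lemma gf_pow_21_primitive:
  assumes "primitive_elem a"
  shows "gf_pow a 21 = 58 \<or> gf_pow a 21 = 59"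
proof -
  have "list_all gf_pow_21_ok vecs"
    by (simp only: vecs_eval list.pred_inject gf_pow_21_ok_def gf_pow_21[unfolded Let_def]
        cube_root_of_1_def gf_mul_eval num_eval)
  moreover have "a \<in> set vecs" "gf_pow a 21 \<noteq> 1"
    using assms by (auto simp: primitive_elem_def F64_def set_vecs)
  ultimately show ?thesis by (auto simp: list_all_iff gf_pow_21_ok_def cube_root_of_1_def)
qed

definition gf_mul_59_ok :: "nat \<Rightarrow> bool" where
  "gf_mul_59_ok x \<longleftrightarrow> 0 < gf_mul 59 x \<and> gf_mul 59 x < 64 \<and> gf_mul 59 (gf_mul 59 x) = gf_mul 58 x"

text \<open>Multiplying by 58 is multiplying by 59 twice, which reduces invariance to the single
  multiplier 59. The vector 0 is not in \<open>vecs\<close> and is handled by linearity.\<close>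

lemma gf_mul_59:
  assumes "x < 64"
  shows "gf_mul 59 x < 64" "gf_mul 59 x = 0 \<longleftrightarrow> x = 0" "gf_mul 59 (gf_mul 59 x) = gf_mul 58 x"
proof -
  have "list_all gf_mul_59_ok vecs"
    by (simp only: vecs_eval list.pred_inject gf_mul_59_ok_def gf_mul_eval num_eval)
  then have "0 < x \<Longrightarrow> gf_mul_59_ok x" using assms by (auto simp: list_all_iff set_vecs)
  then show "gf_mul 59 x < 64" "gf_mul 59 x = 0 \<longleftrightarrow> x = 0" "gf_mul 59 (gf_mul 59 x) = gf_mul 58 x"
    by (cases "x = 0"; simp add: gf_mul_59_ok_def gf_mul_0)+
qed

definition label_59_ok :: "nat \<times> nat \<times> nat \<Rightarrow> bool" where
  "label_59_ok = (\<lambda>(x, y, z).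
     label (canonize3 (gf_mul 59 x) (gf_mul 59 y) (gf_mul 59 z)) = label (x, y, z))"

lemma label_59_ok_eval:
  "label_59_ok (x, y, z) \<longleftrightarrow>
     label (canonize3 (gf_mul 59 x) (gf_mul 59 y) (gf_mul 59 z)) = label (x, y, z)"
  by (simp add: label_59_ok_def)

text \<open>Labels, rather than the separate codes, are shown to be invariant, which covers every
  union of label classes at once.\<close>

lemma label_canonize3:
  assumes "canon3 x y z"
  shows "label (canonize3 (gf_mul 59 x) (gf_mul 59 y) (gf_mul 59 z)) = label (x, y, z)"
proof -
  have "list_all label_59_ok canon_planes"
    by (simp only: canon_planes_eval list.pred_inject label_59_ok_eval label_eval canonize3_def
        canonize2_eval insert_reduced_eval min_eval select_eval Let_def prod.case gf_mul_eval num_eval)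
  then show ?thesis using assms set_canon_planes by (auto simp: list_all_iff label_59_ok_def)
qed

section \<open>From the table to the graph\<close>

definition label_of :: "nat set \<Rightarrow> nat" where
  "label_of V = label (key3 V)"

lemma label_of_gf_mul_59:
  assumes "V \<in> J263_vertices"
  shows "gf_mul 59 ` V \<in> J263_vertices" "label_of (gf_mul 59 ` V) = label_of V"
proof -
  obtain x y z where xyz: "canon3 x y z" "V = span3 x y z"
    using assms obtain_span3[of V] by (auto simp: J263_vertices_def)
  note d = canon3D[OF xyz(1)] and c = canon2D[OF canon3D(1)[OF xyz(1)]]
  define f where "f = gf_mul 59"
  have f: "f (u \<oplus> v) = f u \<oplus> f v" "f 0 = 0" for u v by (simp_all add: f_def gf_mul_add gf_mul_0)
  have f0: "f u = 0 \<longleftrightarrow> u = 0" "f u < 64" if "u < 64" for u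
    using gf_mul_59[OF that] by (simp_all add: f_def)
  \<comment> \<open>By additivity, injectivity amounts to a trivial kernel.\<close>
  have inj: "f u = f v \<longleftrightarrow> u = v" if "u < 64" "v < 64" for u v
    using f0[OF gf_add_less_64[OF that]] by (simp add: f(1))
  have image: "f ` V = span3 (f x) (f y) (f z)" by (simp add: xyz(2) span3_def f)
  have "f z \<notin> span2 (f x) (f y)"
  proof
    assume "f z \<in> span2 (f x) (f y)"
    then have "f z \<in> f ` span2 x y" by (simp add: span2_def f)
    then have "z \<in> span2 x y" using inj has_dimD(6)[OF has_dim_canon2[OF d(1)]] d by auto
    then show False using d by simp
  qed
  then have indep: "0 < f x" "0 < f y" "f x \<noteq> f y" "f x < 64" "f y < 64" "f z \<notin> span2 (f x) (f y)"
    "f z < 64"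
    using c d f0 inj by (auto simp flip: neq0_conv)
  then show "gf_mul 59 ` V \<in> J263_vertices"
    using has_dim_span3[of "f x" "f y" "f z"] image by (simp add: J263_vertices_def f_def)
  obtain p q r where pqr: "canonize3 (f x) (f y) (f z) = (p, q, r)" by (metis prod_cases3)
  note can = canonize3[OF indep pqr]
  have "label_of (f ` V) = label (canonize3 (f x) (f y) (f z))"
    using key3_span3[OF can(1)] can(2) by (simp add: image label_of_def pqr)
  also have "\<dots> = label_of V"
    using label_canonize3[OF xyz(1)] key3_span3[OF xyz(1)] by (simp add: f_def label_of_def xyz(2))
  finally show "label_of (gf_mul 59 ` V) = label_of V" by (simp add: f_def)
qed

lemma sum_planes_over:
  assumes "canon2 x y"
  shows "(\<Sum>W\<in>planes_over (span2 x y). g W) = (\<Sum>z\<leftarrow>coset_mins x y. g (span3 x y z))"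
  using sum.reindex_bij_betw[OF planes_over_span2[OF assms], of g]
  by (simp add: sum_list_distinct_conv_sum_set distinct_coset_mins set_coset_mins)

lemma sum_weight_planes_over:
  assumes "canon2 x y"
  shows "(\<Sum>W\<in>planes_over (span2 x y). weight (label_of W)) = degree x y"
proof -
  have "label_of (span3 x y z) = label (insert_reduced x y z)" if "z \<in> set (coset_mins x y)" for z
  proof -
    obtain p q r where pqr: "insert_reduced x y z = (p, q, r)" by (metis prod_cases3)
    note ins = insert_reduced[OF assms _ _ _ _ pqr]
    have "canon3 p q r" "span3 p q r = span3 x y z" using ins that by (auto simp: set_coset_mins)
    then show ?thesis using key3_span3[of p q r] by (simp add: label_of_def pqr)
  qed
  then show ?thesis
    unfolding sum_planes_over[OF assms] degree_def by (intro arg_cong[of _ _ sum_list] map_cong) auto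
qed

lemma sum_lines_of:
  assumes "canon3 x y z"
  shows "(\<Sum>U\<in>lines_of (span3 x y z). h U) =
    h (span2 x y) + (h (span2 x z) + (h (span2 y z) + (h (span2 x (y \<oplus> z)) + (h (span2 y (x \<oplus> z)) +
      (h (span2 (x \<oplus> y) z) + h (span2 (x \<oplus> y) (x \<oplus> z)))))))"
proof -
  have "distinct [(x, y), (x, z), (y, z), (x, y \<oplus> z), (y, x \<oplus> z), (x \<oplus> y, z), (x \<oplus> y, x \<oplus> z)]"
    using lines_of_span3(2)[OF assms] by (intro card_distinct) simp
  then show ?thesis
    using sum.reindex_bij_betw[OF lines_of_span3(1)[OF assms], of h, symmetric] by simp
qed

lemma sum_weight:
  assumes "V \<in> J263_vertices"
  shows "(\<Sum>U\<in>lines_of V. \<Sum>W\<in>planes_over U. weight (label_of W)) = 24018015012 + 12 * weight (label_of V)"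
proof -
  obtain x y z where xyz: "canon3 x y z" "V = span3 x y z"
    using assms obtain_span3[of V] by (auto simp: J263_vertices_def)
  have "(\<Sum>U\<in>lines_of V. \<Sum>W\<in>planes_over U. weight (label_of W)) = plane_sum x y z"
    unfolding xyz(2) sum_lines_of[OF xyz(1)] plane_sum_def
    by (simp add: sum_weight_planes_over lines_of_span3(3)[OF xyz(1)])
  then show ?thesis using plane_sum[OF xyz(1)] key3_span3[OF xyz(1)] by (simp add: label_of_def xyz(2))
qed

section \<open>Separating the four packed counts\<close>

definition label_count :: "nat set \<Rightarrow> nat set \<Rightarrow> nat" where
  "label_count S V = (\<Sum>U\<in>lines_of V. \<Sum>W\<in>planes_over U. of_bool (label_of W \<in> S))"

text \<open>There are at most 7 * 15 = 105 incidences, so the packed sums produce no carry in base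
  1000.\<close>

lemma label_count_less:
  assumes "V \<in> J263_vertices"
  shows "label_count S V < 1000"
proof -
  have "(\<Sum>W\<in>planes_over U. of_bool (label_of W \<in> S)) \<le> (15 :: nat)" if "U \<in> lines_of V" for U
    using sum_bounded_above[of "planes_over U" "\<lambda>W. of_bool (label_of W \<in> S)" "1 :: nat"]
      card_planes_over[of U] that by (simp add: lines_of_def)
  then have "label_count S V \<le> card (lines_of V) * 15"
    unfolding label_count_def by (metis (no_types, lifting) sum_bounded_above of_nat_id)
  then show ?thesis using card_lines_of[OF assms] by simp
qed

lemma label_count_Un:
  assumes "S \<inter> T = {}"
  shows "label_count (S \<union> T) V = label_count S V + label_count T V"
proof -
  have "of_bool (e \<in> S \<union> T) = of_bool (e \<in> S) + (of_bool (e \<in> T) :: nat)" for e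
    using assms by auto
  then show ?thesis by (simp add: label_count_def sum.distrib)
qed

lemma base_1000_unique:
  fixes a b m n :: nat
  assumes "a + 1000 * m = b + 1000 * n" "a < 1000" "b < 1000"
  shows "a = b" "m = n"
proof -
  have "(a + 1000 * m) mod 1000 = (b + 1000 * n) mod 1000" using assms(1) by simp
  then show "a = b" using assms(2,3) by simp
  then show "m = n" using assms(1) by simp
qed

lemma label_count:
  assumes "V \<in> J263_vertices"
  shows "label_count {1, 5} V = 12 + 12 * of_bool (label_of V \<in> {1, 5})"
    and "label_count {2} V = 15 + 12 * of_bool (label_of V \<in> {2})"
    and "label_count {3} V = 18 + 12 * of_bool (label_of V \<in> {3})"
    and "label_count {4, 5} V = 24 + 12 * of_bool (label_of V \<in> {4, 5})"
proof -
  define b :: "nat set \<Rightarrow> nat" where "b S = of_bool (label_of V \<in> S)" for S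
  have b: "b S \<le> 1" for S by (simp add: b_def)
  have "label_count {1, 5} V + 1000 * (label_count {2} V + 1000 * (label_count {3} V +
      1000 * label_count {4, 5} V)) = (\<Sum>U\<in>lines_of V. \<Sum>W\<in>planes_over U. weight (label_of W))"
    by (simp only: label_count_def weight_def sum.distrib flip: sum_distrib_left)
  also have "\<dots> = 24018015012 + 12 * weight (label_of V)" by (rule sum_weight[OF assms])
  also have "\<dots> = (12 + 12 * b {1, 5}) + 1000 * ((15 + 12 * b {2}) + 1000 * ((18 + 12 * b {3}) +
      1000 * (24 + 12 * b {4, 5})))"
    by (simp add: weight_def b_def)
  finally have eq: "label_count {1, 5} V + 1000 * (label_count {2} V + 1000 * (label_count {3} V +
      1000 * label_count {4, 5} V)) = \<dots>" .
  have small: "k + 12 * b S < 1000" if "k < 900" for k S using that b[of S] by linarith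
  note less = label_count_less[OF assms]
  \<comment> \<open>The digits are split off from the lowest upwards: the first conclusion gives a
    digit, the second the equation for the remaining ones. The last application gives two
    digits.\<close>
  note eq1 = base_1000_unique[OF eq less small]
  note eq2 = base_1000_unique[OF eq1(2) less small]
  note eq3 = base_1000_unique[OF eq2(2) less small]
  show "label_count {1, 5} V = 12 + 12 * of_bool (label_of V \<in> {1, 5})"
    and "label_count {2} V = 15 + 12 * of_bool (label_of V \<in> {2})"
    and "label_count {3} V = 18 + 12 * of_bool (label_of V \<in> {3})"
    and "label_count {4, 5} V = 24 + 12 * of_bool (label_of V \<in> {4, 5})"
    using eq1(1) eq2(1) eq3 by (simp_all add: b_def)
qed

lemma CR1_code_label:
  assumes "primitive_elem a" "0 < g" "g < 93"
    and count: "\<And>V. V \<in> J263_vertices \<Longrightarrow> label_count S V = g + 12 * of_bool (label_of V \<in> S)"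
  shows "\<exists>C. CR1_code C (93 - g) g \<and> invariant_under C (Gamma21 a)"
proof (intro exI conjI)
  define C where "C = {V \<in> J263_vertices. label_of V \<in> S}"
  show "CR1_code C (93 - g) g"
  proof (rule CR1_codeI)
    fix V assume V: "V \<in> J263_vertices"
    have "(\<Sum>U\<in>lines_of V. \<Sum>W\<in>planes_over U. of_bool (W \<in> C)) = label_count S V"
      unfolding label_count_def by (intro sum.cong) (auto simp: C_def planes_over_def)
    then show "(\<Sum>U\<in>lines_of V. \<Sum>W\<in>planes_over U. of_bool (W \<in> C)) = g + 12 * of_bool (V \<in> C)"
      using count[OF V] V by (simp add: C_def)
  qed (use assms in \<open>auto simp: C_def\<close>)
  have mul_59: "gf_mul 59 ` V \<in> C" if "V \<in> C" for V
    using that label_of_gf_mul_59[of V] by (simp add: C_def)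
  have sub: "V \<subseteq> F64" if "V \<in> C" for V
    using that has_dimD(4) by (auto simp: C_def J263_vertices_def)
  \<comment> \<open>Covers the case that \<open>gf_pow a 21\<close> is 58 instead of 59.\<close>
  have "gf_mul 58 ` V \<in> C" if "V \<in> C" for V
  proof -
    have "gf_mul 58 ` V = gf_mul 59 ` gf_mul 59 ` V"
      using sub[OF that] gf_mul_59(3) by (force simp: image_image F64_def intro!: image_cong)
    then show ?thesis using mul_59 that by simp
  qed
  then show "invariant_under C (Gamma21 a)"
    using gf_pow_21_primitive[OF assms(1)] mul_59 sub by (intro invariant_under_Gamma21I) auto
qed

theorem theorem7p1:
  fixes a :: nat and g1 :: nat
  assumes "primitive_elem a"
    and "g1 \<in> {12, 15, 18, 24, 27, 30}"
  shows "\<exists>C. CR1_code C (93 - g1) g1 \<and> invariant_under C (Gamma21 a)"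
proof -
  note code = CR1_code_label[OF assms(1)]
  \<comment> \<open>The label sets are disjoint, so both the constants and the indicator terms add
    up.\<close>
  have 27: "label_count ({1, 5} \<union> {2}) V = 27 + 12 * of_bool (label_of V \<in> {1, 5} \<union> {2})"
    and 30: "label_count ({1, 5} \<union> {3}) V = 30 + 12 * of_bool (label_of V \<in> {1, 5} \<union> {3})"
    if "V \<in> J263_vertices" for V
    using label_count[OF that] by (subst label_count_Un; auto)+
  from assms(2) consider "g1 = 12" | "g1 = 15" | "g1 = 18" | "g1 = 24" | "g1 = 27" | "g1 = 30"
    by auto
  then show ?thesis
    by cases (use code[OF _ _ label_count(1)] code[OF _ _ label_count(2)] code[OF _ _ label_count(3)]
      code[OF _ _ label_count(4)] code[OF _ _ 27] code[OF _ _ 30] in simp_all)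
qed

end
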